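(* Let $\mathcal{C}$ be a hereditary graph class (closed under taking induced subgraphs), and suppose that for each positive integer $n$ some twisted chain graph of order $n$ belongs to $\mathcal{C}$. Then $\mathcal{C}$ does not admit low rank-width colorings.
   Context: All graphs are finite and simple. For a positive integer $n$, a twisted chain graph of order $n$ is a graph on $3n^2$ vertices $A\cup B\cup C$ with $A=\{v_1,\dots,v_{n^2}\}$, $B=\{w_1,\dots,w_{n^2}\}$, $C=\{z_{(i,j)}\colon 1\le i,j\le n\}$ such that: for all $x,y,i,j\in\{1,\dots,n\}$ and $k=n(x-1)+y$, $v_k$ is adjacent to $z_{(i,j)}$ iff ($x<i$) or ($x=i$ and $y\le j$); $w_k$ is adjacent to $z_{(i,j)}$ iff ($x<j$) or ($x=j$ and $y\le i$); and the edge relation within $A\cup B$ and within $C$ is arbitrary. Rank-width: for a graph $G$ and $X\subseteq V(G)$, $\mathrm{cutrk}_G(X)$ is the rank over GF(2) of the adjacency submatrix with rows $X$ and columns $V(G)\setminus X$; a rank-decomposition is a tree with all nodes of degree 1 or 3 whose leaves are in bijection with $V(G)$, an edge $e$ has width $\mathrm{cutrk}_G$ of the vertex set on one side of $e$, and the rank-width is the minimum over rank-decompositions of the maximum edge width ($0$ for graphs with at most one vertex). A class $\mathcal{D}$ of graphs admits low rank-width colorings if there exist functions $N,Q\colon\mathbb{N}\to\mathbb{N}$ such that for all $p\in\mathbb{N}$, every $G\in\mathcal{D}$ can be vertex colored with at most $N(p)$ colors such that the union of any $i\le p$ color classes induces a subgraph of rank-width at most $Q(i)$. *)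

theory Defs
  imports
    "Graph_Theory.Graph_Theory"
    "HOL-Library.Z2"
    "HOL-Library.Function_Algebras"
begin

text \<open>
  Finite simple graphs are the finite, symmetric, loop-free digraphs of the locale
  \<^locale>\<open>pair_graph\<close>; an undirected edge between \<open>u\<close> and \<open>v\<close> is the pair of arcs
  \<open>(u, v)\<close>, \<open>(v, u)\<close>.
\<close>

definition induce :: "'a pair_pre_digraph \<Rightarrow> 'a set \<Rightarrow> 'a pair_pre_digraph" where
  "induce G S = \<lparr>pverts = S, parcs = parcs G \<inter> S \<times> S\<rparr>"

lemma with_proj_induce: "with_proj (induce G S) = with_proj G \<restriction> S"
  by (auto simp: induce_def induce_subgraph_def with_proj_def)

text \<open>
  In a symmetric digraph a closed walk \<open>a, b, a\<close> along one edge counts as a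
  \<^const>\<open>pre_digraph.cycle\<close>, so the library's \<^const>\<open>tree\<close> is not the undirected notion:
  only cycles of length at least three are cycles of the undirected graph.
  \<^const>\<open>connected\<close> includes nonemptiness.
\<close>

definition undirected_tree :: "'a pair_pre_digraph \<Rightarrow> bool" where
  "undirected_tree T \<longleftrightarrow>
     pair_graph T \<and> connected (with_proj T) \<and>
     \<not> (\<exists>p. pre_digraph.cycle (with_proj T) p \<and> 3 \<le> length p)"

abbreviation degree :: "'a pair_pre_digraph \<Rightarrow> 'a \<Rightarrow> nat" where
  "degree G v \<equiv> out_degree (with_proj G) v"

definition leaves :: "'a pair_pre_digraph \<Rightarrow> 'a set" where
  "leaves T = {t \<in> pverts T. degree T t = 1}"

definition delete_edge :: "'a pair_pre_digraph \<Rightarrow> 'a \<times> 'a \<Rightarrow> 'a pair_pre_digraph" where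
  "delete_edge T e = \<lparr>pverts = pverts T, parcs = parcs T - {(fst e, snd e), (snd e, fst e)}\<rparr>"

text \<open>
  The rank of the submatrix with rows \<open>X\<close> and columns \<open>V(G) - X\<close> is the dimension of its row
  space over the two-element field. Rows are functions on the whole vertex type,
  extended by zero outside the columns.
\<close>

interpretation bit_fun: vector_space "\<lambda>(c::bit) (f::'a \<Rightarrow> bit) x. c * f x"
  by unfold_locales (auto simp: fun_eq_iff algebra_simps)

definition cut_row :: "'a pair_pre_digraph \<Rightarrow> 'a set \<Rightarrow> 'a \<Rightarrow> 'a \<Rightarrow> bit" where
  "cut_row G X u = (\<lambda>w. if w \<in> pverts G - X \<and> (u, w) \<in> parcs G then 1 else 0)"

definition cut_rank :: "'a pair_pre_digraph \<Rightarrow> 'a set \<Rightarrow> nat" where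
  "cut_rank G X = bit_fun.dim (cut_row G X ` X)"

text \<open>
  Every finite tree is isomorphic to one with natural numbers as nodes, so taking the nodes
  of decomposition trees from \<^typ>\<open>nat\<close> is no restriction.
\<close>

definition rank_decomposition ::
    "'a pair_pre_digraph \<Rightarrow> nat pair_pre_digraph \<Rightarrow> (nat \<Rightarrow> 'a) \<Rightarrow> bool" where
  "rank_decomposition G T L \<longleftrightarrow>
     undirected_tree T \<and> (\<forall>t \<in> pverts T. degree T t = 1 \<or> degree T t = 3) \<and>
     bij_betw L (leaves T) (pverts G)"

text \<open>
  The side of an edge \<open>e\<close> is the one containing \<^term>\<open>fst e\<close>; as \<open>parcs T\<close> contains both
  orientations of each edge, the maximum below runs over both sides.
\<close>

definition edge_side ::
    "nat pair_pre_digraph \<Rightarrow> (nat \<Rightarrow> 'a) \<Rightarrow> nat \<times> nat \<Rightarrow> 'a set" where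
  "edge_side T L e = L ` {t \<in> leaves T. fst e \<rightarrow>\<^sup>*\<^bsub>with_proj (delete_edge T e)\<^esub> t}"

definition decomposition_width ::
    "'a pair_pre_digraph \<Rightarrow> nat pair_pre_digraph \<Rightarrow> (nat \<Rightarrow> 'a) \<Rightarrow> nat" where
  "decomposition_width G T L = Max ((\<lambda>e. cut_rank G (edge_side T L e)) ` parcs T)"

definition rank_width :: "'a pair_pre_digraph \<Rightarrow> nat" where
  "rank_width G =
     (if card (pverts G) \<le> 1 then 0
      else (LEAST k. \<exists>T L. rank_decomposition G T L \<and> decomposition_width G T L = k))"

definition hereditary_graph_class :: "'a pair_pre_digraph set \<Rightarrow> bool" where
  "hereditary_graph_class \<C> \<longleftrightarrow>
     (\<forall>G \<in> \<C>. pair_graph G \<and> (\<forall>S \<subseteq> pverts G. induce G S \<in> \<C>))"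

definition admits_low_rank_width_colorings :: "'a pair_pre_digraph set \<Rightarrow> bool" where
  "admits_low_rank_width_colorings \<D> \<longleftrightarrow>
     (\<exists>N Q :: nat \<Rightarrow> nat. \<forall>p. \<forall>G \<in> \<D>. \<exists>c :: 'a \<Rightarrow> nat.
        card (c ` pverts G) \<le> N p \<and>
        (\<forall>I \<subseteq> c ` pverts G. card I \<le> p \<longrightarrow>
           rank_width (induce G {v \<in> pverts G. c v \<in> I}) \<le> Q (card I)))"

definition twisted_chain_graph :: "nat \<Rightarrow> 'a pair_pre_digraph \<Rightarrow> bool" where
  "twisted_chain_graph n G \<longleftrightarrow>
     pair_graph G \<and>
     (\<exists>(v :: nat \<Rightarrow> 'a) (w :: nat \<Rightarrow> 'a) (z :: nat \<times> nat \<Rightarrow> 'a).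
        inj_on v {1..n\<^sup>2} \<and> inj_on w {1..n\<^sup>2} \<and> inj_on z ({1..n} \<times> {1..n}) \<and>
        v ` {1..n\<^sup>2} \<inter> w ` {1..n\<^sup>2} = {} \<and>
        v ` {1..n\<^sup>2} \<inter> z ` ({1..n} \<times> {1..n}) = {} \<and>
        w ` {1..n\<^sup>2} \<inter> z ` ({1..n} \<times> {1..n}) = {} \<and>
        pverts G = v ` {1..n\<^sup>2} \<union> w ` {1..n\<^sup>2} \<union> z ` ({1..n} \<times> {1..n}) \<and>
        (\<forall>x \<in> {1..n}. \<forall>y \<in> {1..n}. \<forall>i \<in> {1..n}. \<forall>j \<in> {1..n}. \<forall>k.
           k = n * (x - 1) + y \<longrightarrow>
           ((v k, z (i, j)) \<in> parcs G \<longleftrightarrow> x < i \<or> x = i \<and> y \<le> j) \<and>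
           ((w k, z (i, j)) \<in> parcs G \<longleftrightarrow> x < j \<or> x = j \<and> y \<le> i)))"

end

(*
  Put a_i := v_{n(i-1)+1} and b_j := w_{n(j-1)+1}, the first vertices of the i-th block of
  A and of the j-th block of B. Then a_i ~ z_{(i',j')} iff i <= i', and b_j ~ z_{(i',j')} iff
  j <= j', so each row of the grid is separated from the earlier ones by a single vertex, and so
  is each column. Colour the cell (i,j) by the colours of a_i, b_j and z_{(i,j)}. For large n the
  pigeonhole principle gives an m x m subgrid of a single colour; its cells and the
  corresponding a_i, b_j use at most three colours.

  Consider a rank-decomposition of the graph induced by these colours, with width at most k,
  and an edge of it that leaves at least a third of the m^2 grid vertices on each side. If a row
  of the subgrid meets both sides, then whichever side a_i is on, some grid vertex of that row is
  on the other one. Taking half of these rows gives a triangular submatrix, so at most 2k rows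
  meet both sides, and likewise at most 2k columns. As m > 2k, all remaining rows and columns lie
  on a common side, and the other side contains at most 4k^2 < m^2/3 grid vertices, a
  contradiction.
*)
theory Submission
  imports Defs
begin

section \<open>Lower bounds on cut-rank from half graphs\<close>

text \<open>Listed by increasing \<open>key\<close>, the submatrix with rows \<open>f i\<close> and
  columns \<open>g j\<close> is triangular with ones on the diagonal, so its rows are independent.
  Keys are integers so that a decreasing order of natural numbers can be given by negation.\<close>

lemma cut_rank_ge_half_graph:
  fixes key :: "'i \<Rightarrow> int"
  assumes "finite X" "finite R"
    and row: "\<And>i. i \<in> R \<Longrightarrow> f i \<in> X"
    and col: "\<And>i. i \<in> R \<Longrightarrow> g i \<in> pverts G - X"
    and diag: "\<And>i. i \<in> R \<Longrightarrow> (f i, g i) \<in> parcs G"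
    and off: "\<And>i j. i \<in> R \<Longrightarrow> j \<in> R \<Longrightarrow> i \<noteq> j \<Longrightarrow> key i \<le> key j \<Longrightarrow> (f i, g j) \<notin> parcs G"
  shows "card R \<le> cut_rank G X"
proof -
  let ?r = "\<lambda>i. cut_row G X (f i)"
  have "bit_fun.independent (?r ` S) \<and> inj_on ?r S" if "S \<subseteq> R" for S
    using finite_subset[OF that \<open>finite R\<close>] that
  proof (induction rule: finite_ranking_induct[where f = key])
    case empty
    then show ?case using bit_fun.independent_empty by (simp only: image_empty inj_on_empty)
  next
    case (insert x S)
    show ?case
    proof (cases "x \<in> S")
      case True
      then show ?thesis using insert by (simp add: insert_absorb)
    next
      case False
      \<comment> \<open>Elements are inserted in order of nondecreasing key, so all earlier rows
        vanish in column \<open>g x\<close>. Vanishing there is a linear condition that the new row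
        violates, which keeps it out of the span of the earlier ones.\<close>
      let ?Z = "{h :: 'a \<Rightarrow> bit. h (g x) = 0}"
      have "bit_fun.subspace ?Z"
        by (rule bit_fun.subspaceI) auto
      moreover have "?r ` S \<subseteq> ?Z"
      proof (intro image_subsetI CollectI)
        fix y assume y: "y \<in> S"
        then have "key y \<le> key x" using insert.hyps by blast
        then have "(f y, g x) \<notin> parcs G" using off[of y x] insert.prems y False by auto
        then show "?r y (g x) = 0" by (simp add: cut_row_def)
      qed
      ultimately have "bit_fun.span (?r ` S) \<subseteq> ?Z"
        by (rule bit_fun.span_minimal[rotated])
      moreover have "?r x (g x) = 1"
        using insert.prems col diag by (simp add: cut_row_def)
      ultimately have nspan: "?r x \<notin> bit_fun.span (?r ` S)" by auto
      have "S \<subseteq> R" using insert.prems by simp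
      then have IH: "bit_fun.independent (?r ` S)" "inj_on ?r S" using insert.IH by simp_all
      show ?thesis
      proof
        show "bit_fun.independent (?r ` insert x S)"
          unfolding image_insert using nspan IH(1) by (rule bit_fun.independent_insertI)
        have "?r x \<notin> ?r ` S" using nspan bit_fun.span_base[of "?r x" "?r ` S"] by satx
        then show "inj_on ?r (insert x S)" using IH(2) False by simp
      qed
    qed
  qed
  then have indep: "bit_fun.independent (?r ` R)" and inj: "inj_on ?r R" by auto
  obtain B where B: "B \<subseteq> cut_row G X ` X" "cut_row G X ` X \<subseteq> bit_fun.span B"
    "card B = cut_rank G X"
    unfolding cut_rank_def using bit_fun.basis_exists by metis
  have "?r ` R \<subseteq> bit_fun.span B" using row B(2) by blast
  moreover have "finite B" using B(1) \<open>finite X\<close> by (simp add: finite_subset)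
  ultimately have "card (?r ` R) \<le> card B"
    using bit_fun.independent_span_bound indep by blast
  then show ?thesis using B(3) inj by (simp add: card_image)
qed

text \<open>Here \<open>Z i\<close> plays the grid vertices of a row or column, and
  \<open>a i\<close> the vertex separating it from the earlier ones. On a line meeting both sides of
  the cut, some vertex of \<open>Z i\<close> lies opposite to \<open>a i\<close>; these pairs form a
  half graph across the cut. The factor 2 accounts for the two possible sides of
  \<open>a i\<close>.\<close>

lemma card_mixed_lines_le:
  fixes I :: "nat set"
  assumes "finite X" "finite I" "symmetric (with_proj G)"
    and a: "\<And>i. i \<in> I \<Longrightarrow> a i \<in> pverts G"
    and Z: "\<And>i. i \<in> I \<Longrightarrow> Z i \<subseteq> pverts G"
    and adj: "\<And>i j y. i \<in> I \<Longrightarrow> j \<in> I \<Longrightarrow> y \<in> Z j \<Longrightarrow> (a i, y) \<in> parcs G \<longleftrightarrow> i \<le> j"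
  shows "card {i \<in> I. Z i \<inter> X \<noteq> {} \<and> Z i - X \<noteq> {}} \<le> 2 * cut_rank G X"
proof -
  let ?M = "{i \<in> I. Z i \<inter> X \<noteq> {} \<and> Z i - X \<noteq> {}}"
  let ?P = "{i \<in> ?M. a i \<in> X}" and ?N = "{i \<in> ?M. a i \<notin> X}"
  have adj': "(y, a i) \<in> parcs G \<longleftrightarrow> i \<le> j" if "i \<in> I" "j \<in> I" "y \<in> Z j" for i j y
    using adj[OF that] \<open>symmetric _\<close> by (auto simp: symmetric_def dest: symD)
  have "\<exists>y. \<forall>i\<in>?M. y i \<in> Z i - X" by (rule bchoice) blast
  then obtain y where y: "\<And>i. i \<in> ?M \<Longrightarrow> y i \<in> Z i - X" by blast
  have "\<exists>x. \<forall>i\<in>?M. x i \<in> Z i \<inter> X" by (rule bchoice) blast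
  then obtain x where x: "\<And>i. i \<in> ?M \<Longrightarrow> x i \<in> Z i \<inter> X" by blast
  have "card ?P \<le> cut_rank G X"
  \<comment> \<open>The entry at \<open>(a i, y j)\<close> vanishes for \<open>j < i\<close>, so the
    rows are sorted by decreasing index.\<close>
  proof (rule cut_rank_ge_half_graph[where f = a and g = y and key = "\<lambda>i. - int i"])
    show "(a i, y j) \<notin> parcs G" if "i \<in> ?P" "j \<in> ?P" "i \<noteq> j" "- int i \<le> - int j" for i j
      using that y[of j] adj[of i j "y j"] by auto
    show "(a i, y i) \<in> parcs G" if "i \<in> ?P" for i
      using that y[of i] adj[of i i "y i"] by auto
    show "y i \<in> pverts G - X" if "i \<in> ?P" for i
      using that y[of i] Z[of i] by auto
  qed (use assms in auto)
  moreover have "card ?N \<le> cut_rank G X"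
  \<comment> \<open>Now the \<open>a j\<close> are the columns and the entry at
    \<open>(x i, a j)\<close> vanishes for \<open>i < j\<close>, which calls for the increasing
    order.\<close>
  proof (rule cut_rank_ge_half_graph[where f = x and g = a and key = int])
    show "(x i, a j) \<notin> parcs G" if "i \<in> ?N" "j \<in> ?N" "i \<noteq> j" "int i \<le> int j" for i j
      using that x[of i] adj'[of j i "x i"] by auto
    show "(x i, a i) \<in> parcs G" if "i \<in> ?N" for i
      using that x[of i] adj'[of i i "x i"] by auto
    show "x i \<in> X" if "i \<in> ?N" for i
      using that x[of i] by auto
  qed (use assms in auto)
  moreover have "card ?M \<le> card ?P + card ?N"
    by (rule order_trans[OF card_mono card_Un_le]) (use \<open>finite I\<close> in auto)
  ultimately show ?thesis by linarith
qed

section \<open>Two-sided grids and monochromatic subgrids\<close>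

text \<open>Some row \<open>i0\<close> and some column \<open>j0\<close> are not mixed, and both
  agree with their common cell. A cell \<open>(i, j)\<close> of the other kind then differs from
  \<open>(i, j0)\<close> and from \<open>(i0, j)\<close>, so its row and its column are both
  mixed.\<close>

lemma grid_minority_card_le:
  fixes I J :: "nat set"
  assumes fin: "finite I" "finite J"
    and rows: "card {i \<in> I. (\<exists>j\<in>J. (i, j) \<in> S) \<and> (\<exists>j\<in>J. (i, j) \<notin> S)} \<le> r"
    and cols: "card {j \<in> J. (\<exists>i\<in>I. (i, j) \<in> S) \<and> (\<exists>i\<in>I. (i, j) \<notin> S)} \<le> r"
    and big: "r < card I" "r < card J"
  shows "card (I \<times> J \<inter> S) \<le> r * r \<or> card (I \<times> J - S) \<le> r * r"
proof -
  let ?R = "{i \<in> I. (\<exists>j\<in>J. (i, j) \<in> S) \<and> (\<exists>j\<in>J. (i, j) \<notin> S)}"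
  let ?C = "{j \<in> J. (\<exists>i\<in>I. (i, j) \<in> S) \<and> (\<exists>i\<in>I. (i, j) \<notin> S)}"
  have "\<exists>i0\<in>I. i0 \<notin> ?R"
    using rows big(1) card_mono[of ?R I] fin by (metis (no_types, lifting) finite_subset mem_Collect_eq not_le order_trans subsetI)
  then obtain i0 where i0: "i0 \<in> I" "i0 \<notin> ?R" by blast
  have "\<exists>j0\<in>J. j0 \<notin> ?C"
    using cols big(2) card_mono[of ?C J] fin by (metis (no_types, lifting) finite_subset mem_Collect_eq not_le order_trans subsetI)
  then obtain j0 where j0: "j0 \<in> J" "j0 \<notin> ?C" by blast
  have card: "card (?R \<times> ?C) \<le> r * r"
    using rows cols by (simp only: card_cartesian_product mult_le_mono)
  have finRC: "finite (?R \<times> ?C)" using fin by simp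
  show ?thesis
  proof (cases "(i0, j0) \<in> S")
    case True
    then have "I \<times> J - S \<subseteq> ?R \<times> ?C" using i0 j0 by blast
    then show ?thesis using card card_mono[OF finRC] order_trans by blast
  next
    case False
    then have "I \<times> J \<inter> S \<subseteq> ?R \<times> ?C" using i0 j0 by blast
    then show ?thesis using card card_mono[OF finRC] order_trans by blast
  qed
qed

lemma ex_large_fibre:
  assumes "finite B" "f \<in> A \<rightarrow> B" "card B * m < card A"
  obtains b where "b \<in> B" "m \<le> card {a \<in> A. f a = b}"
proof -
  have "finite A" "A \<noteq> {}" using assms(3) by (auto intro: card_ge_0_finite)
  moreover from this have "B \<noteq> {}" using assms(2) by auto
  ultimately obtain b where b: "b \<in> B" "card A \<le> card (f -` {b} \<inter> A) * card B"
    using pigeonhole_card[OF assms(2) _ assms(1)] by blast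
  have "card B * m < card B * card (f -` {b} \<inter> A)"
    using assms(3) b(2) by (simp only: mult.commute less_le_trans)
  moreover have "f -` {b} \<inter> A = {a \<in> A. f a = b}" by auto
  ultimately show thesis using b(1) that by simp
qed

text \<open>Pigeonhole twice: first inside each row, for \<open>m\<close> cells of one colour, then
  among the rows, for \<open>m\<close> rows with the same colour and the same column set.\<close>

lemma ex_monochromatic_subgrid:
  fixes C m :: nat
  obtains n where "1 \<le> n" "\<And>f :: nat \<times> nat \<Rightarrow> 'c. card (f ` ({1..n} \<times> {1..n})) \<le> C \<Longrightarrow>
    \<exists>I \<subseteq> {1..n}. \<exists>J \<subseteq> {1..n}. \<exists>b. card I = m \<and> card J = m \<and> (\<forall>i\<in>I. \<forall>j\<in>J. f (i, j) = b)"
proof -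
  \<comment> \<open>Only the first \<open>M\<close> columns are searched, so the number of pairs of
    a colour and a column set is at most \<open>C * 2 ^ M\<close>, independently of
    \<open>n\<close>. The summand \<open>M\<close> in \<open>n\<close> ensures
    \<open>M \<le> n\<close> and makes the second pigeonhole bound strict.\<close>
  define M where "M = C * m + 1"
  define n where "n = C * 2 ^ M * m + M"
  show thesis
  proof (rule that)
    show "1 \<le> n" by (simp add: n_def M_def)
    fix f :: "nat \<times> nat \<Rightarrow> 'c"
    let ?K = "f ` ({1..n} \<times> {1..n})"
    assume K: "card ?K \<le> C"
    have "\<exists>bJ. fst bJ \<in> ?K \<and> snd bJ \<subseteq> {1..M} \<and> card (snd bJ) = m \<and> (\<forall>j\<in>snd bJ. f (i, j) = fst bJ)"
      if "i \<in> {1..n}" for i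
    proof -
      have "M \<le> n" by (simp add: n_def)
      then have "(\<lambda>j. f (i, j)) \<in> {1..M} \<rightarrow> ?K" using that by auto
      moreover have "card ?K * m < card {1..M}"
        using mult_le_mono1[OF K, of m] by (simp only: card_atLeastAtMost M_def)
      ultimately obtain b where b: "b \<in> ?K" "m \<le> card {j \<in> {1..M}. f (i, j) = b}"
        by (rule ex_large_fibre[rotated]) auto
      obtain J where "J \<subseteq> {j \<in> {1..M}. f (i, j) = b}" "card J = m"
        using obtain_subset_with_card_n[OF b(2)] by metis
      then show ?thesis using b(1) by (intro exI[of _ "(b, J)"]) auto
    qed
    then obtain h where h: "\<And>i. i \<in> {1..n} \<Longrightarrow> fst (h i) \<in> ?K \<and> snd (h i) \<subseteq> {1..M} \<and>
        card (snd (h i)) = m \<and> (\<forall>j\<in>snd (h i). f (i, j) = fst (h i))"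
      by metis
    have "h \<in> {1..n} \<rightarrow> ?K \<times> Pow {1..M}" using h by (auto simp: mem_Times_iff)
    moreover have "card (?K \<times> Pow {1..M}) * m < card {1..n}"
    proof -
      have "card (?K \<times> Pow {1..M}) * m \<le> C * 2 ^ M * m"
        using K by (intro mult_le_mono1) (simp add: card_cartesian_product card_Pow)
      also have "\<dots> < n" by (simp add: n_def M_def)
      finally show ?thesis by (simp only: card_atLeastAtMost diff_Suc_1)
    qed
    ultimately obtain p where p: "m \<le> card {i \<in> {1..n}. h i = p}"
      by (rule ex_large_fibre[rotated]) auto
    obtain I where I: "I \<subseteq> {i \<in> {1..n}. h i = p}" "card I = m"
      using obtain_subset_with_card_n[OF p] by metis
    show "\<exists>I \<subseteq> {1..n}. \<exists>J \<subseteq> {1..n}. \<exists>b. card I = m \<and> card J = m \<and> (\<forall>i\<in>I. \<forall>j\<in>J. f (i, j) = b)"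
    \<comment> \<open>The properties of \<open>p\<close> are read off from a row in
      \<open>I\<close>, which exists only for positive \<open>m\<close>.\<close>
    proof (cases "m = 0")
      case True
      then show ?thesis by (intro exI[of _ "{}"]) auto
    next
      case False
      then obtain i where "i \<in> I" using I(2) by fastforce
      then have "snd p \<subseteq> {1..M}" "card (snd p) = m" using h[of i] I(1) by auto
      moreover have "\<forall>i\<in>I. \<forall>j\<in>snd p. f (i, j) = fst p" using h I(1) by fastforce
      moreover have "{1..M} \<subseteq> {1..n}" by (simp add: n_def)
      ultimately show ?thesis using I by (intro exI[of _ I] conjI exI[of _ "snd p"] exI[of _ "fst p"]) auto
    qed
  qed
qed

section \<open>Sides of an edge and balanced edges\<close>

text \<open>The component of \<open>a\<close> once the edge between \<open>a\<close> and
  \<open>b\<close> is deleted, for a bare relation; \<open>edge_side\<close> is the image under the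
  labelling of the leaves in it.\<close>

definition side :: "'n rel \<Rightarrow> 'n \<Rightarrow> 'n \<Rightarrow> 'n set" where
  "side E a b = {t. (a, t) \<in> (E - {(a, b), (b, a)})\<^sup>*}"

lemma side_refl: "a \<in> side E a b"
  by (simp add: side_def)

lemma side_step:
  assumes "y \<in> side E a b" "(y, z) \<in> E - {(a, b), (b, a)}"
  shows "z \<in> side E a b"
  using assms unfolding side_def mem_Collect_eq by (rule rtrancl_into_rtrancl)

lemma side_induct [consumes 1, case_names base step]:
  assumes "t \<in> side E a b" "P a"
    and "\<And>y z. y \<in> side E a b \<Longrightarrow> (y, z) \<in> E - {(a, b), (b, a)} \<Longrightarrow> P y \<Longrightarrow> P z"
  shows "P t"
  using assms(1) unfolding side_def mem_Collect_eq
  by (induction rule: rtrancl_induct) (use assms(2,3) in \<open>auto simp: side_def\<close>)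

text \<open>After its last visit to \<open>a\<close>, a walk leaves through some neighbour
  \<open>c\<close> and never uses that edge again. In the induction, a step into \<open>a\<close>
  discards the walk so far and a step out of \<open>a\<close> chooses \<open>c\<close>
  afresh.\<close>

lemma side_cases:
  assumes "t \<in> side E a b"
  shows "t = a \<or> (\<exists>c. (a, c) \<in> E \<and> c \<noteq> b \<and> t \<in> side E c a)"
  using assms
proof (induction rule: side_induct)
  case base
  then show ?case by simp
next
  case (step y z)
  show ?case
  proof (cases "y = a")
    case True
    then have "(a, z) \<in> E" "z \<noteq> b" using step.hyps(2) by auto
    then show ?thesis using side_refl by fast
  next
    case False
    then obtain c where c: "(a, c) \<in> E" "c \<noteq> b" "y \<in> side E c a"
      using step.IH by blast
    show ?thesis
    proof (cases "z = a")
      case False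
      then have "(y, z) \<in> E - {(c, a), (a, c)}" using step.hyps(2) \<open>y \<noteq> a\<close> by auto
      then show ?thesis using c side_step by fast
    qed simp
  qed
qed

text \<open>By the bridge property, walks counted in \<open>side E c a\<close> never meet
  \<open>a\<close>, so they cannot use the edge between \<open>a\<close> and \<open>b\<close>
  either; \<open>a\<close> itself makes the inclusion strict. This drives the minimality argument
  for balanced edges.\<close>

lemma side_psubset:
  assumes bridge: "(c, a) \<notin> (E - {(c, a), (a, c)})\<^sup>*" and "(a, c) \<in> E" "c \<noteq> b"
  shows "side E c a \<subset> side E a b"
proof -
  have a: "a \<notin> side E c a" using bridge by (simp add: side_def)
  have "t \<in> side E a b" if "t \<in> side E c a" for t
    using that
  proof (induction rule: side_induct)
    case base
    have "c \<noteq> a" using a side_refl by fast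
    then show ?case using assms(2,3) by (intro side_step[OF side_refl]) auto
  next
    case (step y z)
    have "z \<in> side E c a" using side_step step.hyps .
    then have "(y, z) \<in> E - {(a, b), (b, a)}" using step.hyps a by auto
    then show ?case by (rule side_step[OF step.IH])
  qed
  then show ?thesis using a side_refl[of a E b] by blast
qed

text \<open>Whenever a walk reaches an end of the edge, that end lies on its own side; every other
  step avoids the edge and stays on the current side.\<close>

lemma side_Un_side:
  assumes "(a, t) \<in> E\<^sup>*"
  shows "t \<in> side E a b \<union> side E b a"
  using assms
proof (induction rule: rtrancl_induct)
  case base
  then show ?case by (simp add: side_refl)
next
  case (step y z)
  show ?case
  proof (cases "z = a \<or> z = b")
    case True
    then show ?thesis using side_refl by fast
  next
    case False
    then have "(y, z) \<in> E - {(a, b), (b, a)}" "(y, z) \<in> E - {(b, a), (a, b)}"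
      using step.hyps by auto
    then show ?thesis using step.IH side_step by fast
  qed
qed

lemma side_subset:
  assumes "E \<subseteq> V \<times> V" "a \<in> V"
  shows "side E a b \<subseteq> V"
proof
  fix t assume "t \<in> side E a b"
  then show "t \<in> V" by (induction rule: side_induct) (use assms in auto)
qed

text \<open>Among the arcs with at least a third of \<open>W\<close> behind them, the one with the fewest nodes
  behind it has at most two thirds of \<open>W\<close> behind it: otherwise one of the at most two further
  edges at its tail would do.\<close>

lemma ex_balanced_edge:
  assumes "finite V" "E \<subseteq> V \<times> V" "sym E"
    and bridge: "\<And>a b. (a, b) \<in> E \<Longrightarrow> (a, b) \<notin> (E - {(a, b), (b, a)})\<^sup>*"
    and conn: "\<And>s t. s \<in> V \<Longrightarrow> t \<in> V \<Longrightarrow> (s, t) \<in> E\<^sup>*"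
    and deg: "\<And>a. a \<in> V \<Longrightarrow> card (E `` {a}) \<le> 3"
    and W: "W \<subseteq> V" "\<And>a. a \<in> W \<Longrightarrow> card (E `` {a}) \<le> 1" "2 \<le> card W"
  obtains a b where "(a, b) \<in> E" "card W \<le> 3 * card (W \<inter> side E a b)"
    "card W \<le> 3 * card (W - side E a b)"
proof -
  have finW: "finite W" using W(1) \<open>finite V\<close> finite_subset by blast
  have finN: "finite (E `` {a})" for a
    using \<open>finite V\<close> \<open>E \<subseteq> V \<times> V\<close> by (auto intro: finite_subset[of _ V])
  let ?P = "\<lambda>(a, b). (a, b) \<in> E \<and> card W \<le> 3 * card (W \<inter> side E a b)"
  \<comment> \<open>Two distinct connected nodes of \<open>W\<close> yield an edge. Its two sides
    cover \<open>W\<close>, so one of them has at least half of \<open>W\<close>.\<close>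
  have "\<exists>e. ?P e"
  proof -
    obtain s t where "s \<in> W" "t \<in> W" "s \<noteq> t"
      using W(3) card_le_Suc0_iff_eq[OF finW] by fastforce
    then have "(s, t) \<in> E\<^sup>*" "s \<noteq> t" using conn W(1) by auto
    then obtain a b where ab: "(a, b) \<in> E" by (auto elim: converse_rtranclE)
    then have ba: "(b, a) \<in> E" using \<open>sym E\<close> by (meson symD)
    have "W \<subseteq> (W \<inter> side E a b) \<union> (W \<inter> side E b a)"
    proof
      fix w assume "w \<in> W"
      then have "(a, w) \<in> E\<^sup>*" using conn ab W(1) \<open>E \<subseteq> V \<times> V\<close> by blast
      from side_Un_side[OF this] \<open>w \<in> W\<close>
      show "w \<in> (W \<inter> side E a b) \<union> (W \<inter> side E b a)" by blast
    qed
    then have "card W \<le> card (W \<inter> side E a b) + card (W \<inter> side E b a)"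
      using finW by (intro order_trans[OF card_mono card_Un_le]) auto
    then have "?P (a, b) \<or> ?P (b, a)" using ab ba by auto
    then show ?thesis by blast
  qed
  then obtain e where e: "?P e" and min: "\<And>e'. ?P e' \<Longrightarrow>
      (case e of (a, b) \<Rightarrow> card (side E a b)) \<le> (case e' of (a, b) \<Rightarrow> card (side E a b))"
    using ex_has_least_nat[of ?P _ "\<lambda>(a, b). card (side E a b)"] by blast
  obtain a b where ab: "e = (a, b)" by fastforce
  have abE: "(a, b) \<in> E" and large: "card W \<le> 3 * card (W \<inter> side E a b)" using e ab by auto
  have aV: "a \<in> V" using abE \<open>E \<subseteq> V \<times> V\<close> by auto
  have fin_side: "finite (side E a b)"
    using side_subset[OF \<open>E \<subseteq> V \<times> V\<close> aV] \<open>finite V\<close> finite_subset by blast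
  have "3 * card (W \<inter> side E a b) \<le> 2 * card W"
  \<comment> \<open>A node of \<open>W\<close> has \<open>b\<close> as its only neighbour, so its
    side is just \<open>{a}\<close>; the bound then rests on \<open>card W\<close> being at least
    2.\<close>
  proof (cases "a \<in> W")
    case True
    then have "card (E `` {a}) \<le> 1" using W(2) by blast
    then have "c = b" if "(a, c) \<in> E" for c
      using card_le_Suc0_iff_eq[OF finN, of a] that abE by auto
    then have "side E a b \<subseteq> {a}" using side_cases by fast
    then have "card (W \<inter> side E a b) \<le> 1"
      using card_mono[of "{a}" "W \<inter> side E a b"] by auto
    then show ?thesis using W(3) by linarith
  next
    case False
    let ?N = "E `` {a} - {b}"
    have "3 * card (W \<inter> side E c a) \<le> card W" if "c \<in> ?N" for c
    proof (rule ccontr)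
      assume *: "\<not> ?thesis"
      have ca: "(c, a) \<in> E" using that \<open>sym E\<close> by (auto dest: symD)
      then have "?P (c, a)" using * by auto
      then have "card (side E a b) \<le> card (side E c a)" using min[of "(c, a)"] ab by auto
      moreover have "side E c a \<subset> side E a b"
        using side_psubset[OF bridge[OF ca]] that by auto
      ultimately show False using psubset_card_mono[OF fin_side, of "side E c a"] by linarith
    qed
    then have "(\<Sum>c\<in>?N. 3 * card (W \<inter> side E c a)) \<le> card ?N * card W"
      using sum_bounded_above[of ?N "\<lambda>c. 3 * card (W \<inter> side E c a)" "card W"] by simp
    also have "\<dots> \<le> 2 * card W"
      using deg[OF aV] abE by (intro mult_le_mono1) (simp add: card_Diff_singleton_if)
    finally have "3 * (\<Sum>c\<in>?N. card (W \<inter> side E c a)) \<le> 2 * card W"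
      by (simp only: sum_distrib_left)
    moreover have "card (W \<inter> side E a b) \<le> (\<Sum>c\<in>?N. card (W \<inter> side E c a))"
    proof -
      have "W \<inter> side E a b \<subseteq> (\<Union>c\<in>?N. W \<inter> side E c a)"
        using False side_cases by fast
      then have "card (W \<inter> side E a b) \<le> card (\<Union>c\<in>?N. W \<inter> side E c a)"
        using finW finN by (intro card_mono) auto
      also have "\<dots> \<le> (\<Sum>c\<in>?N. card (W \<inter> side E c a))"
        using finN by (intro card_UN_le) auto
      finally show ?thesis .
    qed
    ultimately show ?thesis by linarith
  qed
  moreover have "card W = card (W \<inter> side E a b) + card (W - side E a b)"
    using card_Int_Diff[OF finW] by simp
  ultimately show thesis using that[OF abE large] by linarith
qed

section \<open>Undirected trees in terms of their arc relation\<close>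

lemma degree_eq_card_Image: "degree T a = card (parcs T `` {a})"
proof -
  have "out_arcs (with_proj T) a = Pair a ` (parcs T `` {a})"
    by (auto simp: out_arcs_def)
  then show ?thesis by (simp add: out_degree_def card_image inj_on_def)
qed

lemma undirected_tree_connected:
  assumes "undirected_tree T" "s \<in> pverts T" "t \<in> pverts T"
  shows "(s, t) \<in> (parcs T)\<^sup>*"
proof -
  interpret pair_graph T using assms by (simp add: undirected_tree_def)
  have "strongly_connected (with_proj T)"
    using assms pair_sym_arcs by (intro symmetric_connected_imp_strongly_connected)
      (auto simp: undirected_tree_def)
  then have "s \<rightarrow>\<^sup>*\<^bsub>with_proj T\<^esub> t" using assms by auto
  then show ?thesis using reachable_conv by auto
qed

text \<open>Reachability in a digraph is reflexive only at its vertices, whereas the closure in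
  \<open>side\<close> is reflexive everywhere; hence the premise on \<open>a\<close>.\<close>

lemma reachable_delete_edge_iff:
  assumes "pair_graph T" "a \<in> pverts T"
  shows "a \<rightarrow>\<^sup>*\<^bsub>with_proj (delete_edge T (a, b))\<^esub> t \<longleftrightarrow> t \<in> side (parcs T) a b"
proof -
  interpret pair_graph T by fact
  interpret D: pair_wf_digraph "delete_edge T (a, b)"
    by unfold_locales (auto simp: delete_edge_def wellformed')
  show ?thesis
    using D.reachable_conv'[of a t] assms by (simp add: side_def delete_edge_def)
qed

text \<open>A path between the ends that avoids the edge would close up with it to a cycle.\<close>

lemma undirected_tree_bridge:
  assumes "undirected_tree T" "(a, b) \<in> parcs T"
  shows "(a, b) \<notin> (parcs T - {(a, b), (b, a)})\<^sup>*"
proof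
  assume reach: "(a, b) \<in> (parcs T - {(a, b), (b, a)})\<^sup>*"
  interpret pair_graph T using assms by (simp add: undirected_tree_def)
  let ?D = "delete_edge T (a, b)"
  interpret D: pair_wf_digraph ?D
    by unfold_locales (auto simp: delete_edge_def wellformed')
  have ab: "a \<in> pverts T" "b \<in> pverts T" "a \<noteq> b"
    using assms(2) wellformed' no_loops' by auto
  have ba: "(b, a) \<in> parcs T" using assms(2) arcs_symmetric by blast
  have "a \<rightarrow>\<^sup>*\<^bsub>with_proj ?D\<^esub> b"
    using reach ab reachable_delete_edge_iff[OF pair_graph] by (simp add: side_def)
  then obtain p where p: "D.apath a p b" using D.reachable_apath by blast
  then have cas: "pcas a p b" and "set p \<subseteq> parcs ?D" and dist: "distinct (pawalk_verts a p)"
    by (auto simp: D.apath_def D.awalk_def)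
  then have arcs: "set p \<subseteq> parcs T - {(a, b), (b, a)}" by (simp add: delete_edge_def)
  have "p \<noteq> []" using cas ab by auto
  \<comment> \<open>A path of one arc would be the deleted edge itself. So \<open>p\<close> has at
    least two arcs and the closed walk at least three, as \<open>undirected_tree\<close> demands of
    a cycle.\<close>
  moreover have "p \<noteq> [e]" for e using cas arcs by (cases e) auto
  ultimately have "2 \<le> length p" by (cases p; cases "tl p") auto
  moreover have "cycle ((b, a) # p)"
    unfolding cycle_def awalk_def using cas arcs dist ab ba by (intro exI[of _ b]) auto
  ultimately have "cycle ((b, a) # p) \<and> 3 \<le> length ((b, a) # p)" by simp
  then show False using assms(1) unfolding undirected_tree_def by blast
qed

section \<open>Existence of rank-decompositions\<close>

lemma pcas_fst_nth_Suc: "pcas u p v \<Longrightarrow> Suc i < length p \<Longrightarrow> fst (p ! Suc i) = snd (p ! i)"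
proof (induction p arbitrary: u i)
  case (Cons e p)
  then show ?case by (cases p; cases i) auto
qed simp

lemma pcas_ends: "pcas u p v \<Longrightarrow> p \<noteq> [] \<Longrightarrow> fst (p ! 0) = u \<and> snd (p ! (length p - 1)) = v"
proof (induction p arbitrary: u)
  case (Cons e p)
  then show ?case by (cases p) auto
qed simp

lemma pawalk_verts_conv_map: "pcas u p v \<Longrightarrow> pawalk_verts u p = u # map snd p"
  by (induction p arbitrary: u) auto

text \<open>The largest node of a long cycle would have two smaller neighbours.\<close>

lemma no_long_cycle:
  fixes T :: "nat pair_pre_digraph"
  assumes "pair_graph T"
    and uniq: "\<And>t s s'. (s, t) \<in> parcs T \<Longrightarrow> (s', t) \<in> parcs T \<Longrightarrow> s < t \<Longrightarrow> s' < t \<Longrightarrow> s = s'"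
    and cycle: "pre_digraph.cycle (with_proj T) p" and "3 \<le> length p"
  shows False
proof -
  interpret pair_graph T by fact
  obtain u where cas: "pcas u p u" and arcs: "set p \<subseteq> parcs T"
    and "distinct (tl (pawalk_verts u p))"
    using cycle by (auto simp: cycle_def awalk_def)
  then have dist: "distinct (map snd p)" by (simp add: pawalk_verts_conv_map)
  let ?n = "length p"
  have p: "p \<noteq> []" using \<open>3 \<le> ?n\<close> by auto
  obtain i where i: "i < ?n" "snd (p ! i) = Max (snd ` set p)"
  proof -
    have "Max (snd ` set p) \<in> snd ` set p" using p by (intro Max_in) auto
    then obtain e where "e \<in> set p" "snd e = Max (snd ` set p)" by force
    then show thesis using that by (auto simp: in_set_conv_nth)
  qed
  \<comment> \<open>Cyclically, \<open>j\<close> is the position before \<open>i\<close> and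
    \<open>k\<close> the one after it. The arcs at \<open>j\<close> and \<open>k\<close> end in the
    two cycle neighbours of the largest node, and length at least 3 makes these positions
    distinct.\<close>
  define j where "j = (if i = 0 then ?n - 1 else i - 1)"
  define k where "k = (if i = ?n - 1 then 0 else i + 1)"
  have jk: "j < ?n" "k < ?n" "j \<noteq> k" using i(1) \<open>3 \<le> ?n\<close> by (auto simp: j_def k_def)
  have in_arcs: "p ! l \<in> parcs T" if "l < ?n" for l using that arcs by auto
  have le: "snd (p ! l) \<le> snd (p ! i)" if "l < ?n" for l
    using that i(2) by simp
  have j: "fst (p ! i) = snd (p ! j)"
    using pcas_fst_nth_Suc[OF cas, of "i - 1"] pcas_ends[OF cas p] i(1) by (auto simp: j_def)
  have k: "fst (p ! k) = snd (p ! i)"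
    using pcas_fst_nth_Suc[OF cas, of i] pcas_ends[OF cas p] i(1) by (auto simp: k_def)
  let ?t = "snd (p ! i)"
  have "(snd (p ! j), ?t) \<in> parcs T" using in_arcs[OF i(1)] j by (metis prod.collapse)
  moreover have "(?t, snd (p ! k)) \<in> parcs T" using in_arcs[OF jk(2)] k by (metis prod.collapse)
  then have "(snd (p ! k), ?t) \<in> parcs T" using arcs_symmetric by blast
  moreover from calculation have "snd (p ! j) \<noteq> ?t" "snd (p ! k) \<noteq> ?t" using no_loops' by blast+
  ultimately have "snd (p ! j) = snd (p ! k)"
    using uniq[of "snd (p ! j)" ?t "snd (p ! k)"] le[OF jk(1)] le[OF jk(2)] by simp
  then show False using dist jk by (simp add: distinct_conv_nth)
qed

text \<open>Having at most one smaller neighbour at each node stands in for acyclicity: it is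
  evidently kept when two new, larger leaves are attached to a leaf.\<close>

definition cubic_tree :: "nat set \<Rightarrow> nat rel \<Rightarrow> bool" where
  "cubic_tree V E \<longleftrightarrow> finite V \<and> E \<subseteq> V \<times> V \<and> sym E \<and> irrefl E \<and> V \<noteq> {} \<and>
     (\<forall>s\<in>V. \<forall>t\<in>V. (s, t) \<in> E\<^sup>*) \<and>
     (\<forall>t s s'. (s, t) \<in> E \<longrightarrow> (s', t) \<in> E \<longrightarrow> s < t \<longrightarrow> s' < t \<longrightarrow> s = s') \<and>
     (\<forall>t\<in>V. card (E `` {t}) = 1 \<or> card (E `` {t}) = 3)"

text \<open>The leaf \<open>l\<close> turns into a node of degree 3 with new leaves \<open>p\<close>
  and \<open>q\<close>, so the number of leaves grows by one. As \<open>p\<close> and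
  \<open>q\<close> exceed all old nodes, no old node gains a smaller neighbour, and theirs is
  \<open>l\<close> alone.\<close>

lemma cubic_tree_extend:
  assumes "cubic_tree V E" and l: "l \<in> V" "card (E `` {l}) = 1"
    and new: "\<And>t. t \<in> V \<Longrightarrow> t < p" "p < q"
  shows "cubic_tree (V \<union> {p, q}) (E \<union> {(l, p), (p, l), (l, q), (q, l)})"
    and "{t \<in> V \<union> {p, q}. card ((E \<union> {(l, p), (p, l), (l, q), (q, l)}) `` {t}) = 1} =
      {t \<in> V. card (E `` {t}) = 1} - {l} \<union> {p, q}"
proof -
  let ?E = "E \<union> {(l, p), (p, l), (l, q), (q, l)}" and ?V = "V \<union> {p, q}"
  have V: "finite V" "E \<subseteq> V \<times> V" "sym E" "irrefl E"
    and conn: "\<And>s t. s \<in> V \<Longrightarrow> t \<in> V \<Longrightarrow> (s, t) \<in> E\<^sup>*"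
    and uniq: "\<And>t s s'. (s, t) \<in> E \<Longrightarrow> (s', t) \<in> E \<Longrightarrow> s < t \<Longrightarrow> s' < t \<Longrightarrow> s = s'"
    and deg: "\<And>t. t \<in> V \<Longrightarrow> card (E `` {t}) = 1 \<or> card (E `` {t}) = 3"
    using assms(1) unfolding cubic_tree_def by blast+
  have pq: "p \<notin> V" "q \<notin> V" "p \<noteq> q" "l \<noteq> p" "l \<noteq> q" "l < p" "l < q"
    using new l(1) by (auto dest: new(1))
  obtain k where k: "E `` {l} = {k}" using l(2) by (auto simp: card_1_singleton_iff)
  then have "k \<in> V" using V(2) by auto
  then have kpq: "k \<noteq> p" "k \<noteq> q" using pq by auto
  have "?E `` {l} = {k, p, q}" using k pq by auto
  then have dl: "card (?E `` {l}) = 3" using kpq pq by simp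
  have dp: "?E `` {p} = {l}" and dq: "?E `` {q} = {l}" using V(2) pq by auto
  have dt: "?E `` {t} = E `` {t}" if "t \<in> V" "t \<noteq> l" for t using that pq by auto
  have to_l: "(s, l) \<in> ?E\<^sup>*" if "s \<in> ?V" for s
  proof (cases "s \<in> V")
    case True
    then show ?thesis using conn[OF True l(1)] rtrancl_mono[of E ?E] by blast
  next
    case False
    then show ?thesis using that by (auto intro!: r_into_rtrancl)
  qed
  have sym: "sym ?E" using \<open>sym E\<close> by (auto simp: sym_def)
  have from_l: "(l, s) \<in> ?E\<^sup>*" if "s \<in> ?V" for s
    using sym_rtrancl[OF sym] to_l[OF that] by (rule symD)
  show "cubic_tree ?V ?E"
    unfolding cubic_tree_def
  proof (intro conjI ballI allI impI)
    show "(s, t) \<in> ?E\<^sup>*" if "s \<in> ?V" "t \<in> ?V" for s t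
      using rtrancl_trans[OF to_l from_l] that by blast
    show "s = s'" if "(s, t) \<in> ?E" "(s', t) \<in> ?E" "s < t" "s' < t" for s s' t
    proof (cases "t = p \<or> t = q")
      case True
      then show ?thesis using that V(2) pq by auto
    next
      case False
      then have "(s, t) \<in> E" "(s', t) \<in> E" using that pq by auto
      then show ?thesis using uniq that by blast
    qed
    show "card (?E `` {t}) = 1 \<or> card (?E `` {t}) = 3" if "t \<in> ?V" for t
    proof (cases "t \<in> V")
      case True
      then show ?thesis using dl dt[OF True] deg[OF True] by (cases "t = l") simp_all
    next
      case False
      then show ?thesis using that dp dq by auto
    qed
    show "finite ?V" using V by simp
    show "?E \<subseteq> ?V \<times> ?V" using V l by auto
    show "sym ?E" by fact
    show "irrefl ?E" using V pq by (auto simp: irrefl_def)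
  qed auto
  show "{t \<in> ?V. card (?E `` {t}) = 1} = {t \<in> V. card (E `` {t}) = 1} - {l} \<union> {p, q}"
    (is "?L = ?R")
  proof (intro set_eqI)
    fix t
    consider "t \<in> V" "t \<noteq> l" | "t = l" | "t = p" | "t = q" | "t \<notin> ?V" by blast
    then show "t \<in> ?L \<longleftrightarrow> t \<in> ?R"
    proof cases
      case 1
      then show ?thesis using dt[OF 1] pq by auto
    next
      case 2
      then show ?thesis using dl pq by simp
    qed (use dp dq pq in auto)
  qed
qed

lemma ex_cubic_tree:
  assumes "card U = n + 2"
  shows "\<exists>V E L. cubic_tree V E \<and> bij_betw L {t \<in> V. card (E `` {t}) = 1} U"
  using assms
proof (induction n arbitrary: U)
  \<comment> \<open>The smallest tree is a single edge, with two leaves.\<close>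
  case 0
  then obtain x y where xy: "U = {x, y}" "x \<noteq> y" by (metis add_0 card_2_iff)
  let ?E = "{(0, 1), (1, 0)} :: nat rel"
  have E: "?E `` {0} = {1}" "?E `` {1} = {0}" by auto
  have "cubic_tree {0, 1} ?E"
    unfolding cubic_tree_def
  proof (intro conjI ballI)
    have "(0, 1) \<in> ?E\<^sup>*" "(1, 0) \<in> ?E\<^sup>*" by (rule r_into_rtrancl, simp)+
    then show "(s, t) \<in> ?E\<^sup>*" if "s \<in> {0, 1}" "t \<in> {0, 1}" for s t
      using that by (elim insertE emptyE) (simp_all only: rtrancl.rtrancl_refl)
    show "card (?E `` {t}) = 1 \<or> card (?E `` {t}) = 3" if "t \<in> {0, 1}" for t
      using that E by (elim insertE emptyE) (simp_all only: card_1_singleton_iff, auto)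
    show "sym ?E" by (auto intro: symI)
    show "irrefl ?E" by (auto intro: irreflI)
  qed auto
  moreover have "card (?E `` {t}) = 1" if "t \<in> {0, 1}" for t
    using that E by (elim insertE emptyE) (simp_all only: card_1_singleton_iff, auto)
  then have "{t \<in> {0, 1}. card (?E `` {t}) = 1} = {0, 1}" by blast
  then have "bij_betw (\<lambda>t. if t = 0 then x else y) {t \<in> {0, 1}. card (?E `` {t}) = 1} U"
    using xy by (auto simp: bij_betw_def inj_on_def)
  ultimately show ?case by blast
next
  case (Suc n)
  then obtain x U' where U: "U = insert x U'" "x \<notin> U'" "card U' = n + 2"
    by (metis add_Suc card_Suc_eq)
  then obtain V E L where T: "cubic_tree V E" and L: "bij_betw L {t \<in> V. card (E `` {t}) = 1} U'"
    using Suc.IH by blast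
  let ?leaves = "{t \<in> V. card (E `` {t}) = 1}"
  have "U' \<noteq> {}" using U(3) by auto
  then obtain l where l: "l \<in> V" "card (E `` {l}) = 1"
    using L by (auto simp: bij_betw_def)
  define p where "p = Suc (Max V)"
  have "finite V" using T by (simp add: cubic_tree_def)
  then have p: "t < p" if "t \<in> V" for t using that by (simp add: p_def less_Suc_eq_le)
  let ?E = "E \<union> {(l, p), (p, l), (l, Suc p), (Suc p, l)}"
  have T': "cubic_tree (V \<union> {p, Suc p}) ?E"
    and leaves': "{t \<in> V \<union> {p, Suc p}. card (?E `` {t}) = 1} = ?leaves - {l} \<union> {p, Suc p}"
    using cubic_tree_extend[OF T l, of p "Suc p"] p by blast+
  \<comment> \<open>The label of the former leaf \<open>l\<close> moves to \<open>p\<close>, and the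
    additional element \<open>x\<close> labels the other new leaf.\<close>
  define L' where "L' = L(p := L l, Suc p := x)"
  have pV: "p \<notin> V" "Suc p \<notin> V" using p by (auto dest: p)
  have "bij_betw L' (?leaves - {l} \<union> {p, Suc p}) U"
    unfolding bij_betw_def
  proof
    have inj: "inj_on L ?leaves" and img: "L ` ?leaves = U'" using L by (auto simp: bij_betw_def)
    have eq: "L' t = L t" if "t \<in> ?leaves" for t using that pV by (auto simp: L'_def)
    have lp: "L' p = L l" "L' (Suc p) = x" by (auto simp: L'_def)
    have "L' ` (?leaves - {l}) = L ` (?leaves - {l})" using eq by (intro image_cong) auto
    also have "\<dots> = U' - {L l}"
      using inj img l by (subst inj_on_image_set_diff[of L ?leaves]) auto
    finally have img': "L' ` (?leaves - {l}) = U' - {L l}" .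
    have "L l \<in> U'" using img l by auto
    then show "L' ` (?leaves - {l} \<union> {p, Suc p}) = U"
      unfolding image_Un img' image_insert image_empty lp U(1) by blast
    have "inj_on L' (?leaves - {l})"
      using inj_on_cong[of "?leaves - {l}" L' L] eq inj_on_diff[OF inj] by blast
    moreover have "L l \<noteq> x" using \<open>L l \<in> U'\<close> U(2) by blast
    then have "inj_on L' {p, Suc p}" by (simp add: lp)
    moreover have "L' ` (?leaves - {l}) \<inter> L' ` {p, Suc p} = {}"
      unfolding img' image_insert image_empty lp using U(2) by blast
    ultimately show "inj_on L' (?leaves - {l} \<union> {p, Suc p})"
      unfolding inj_on_Un by blast
  qed
  then show ?case unfolding leaves'[symmetric] using T' by blast
qed

text \<open>This makes the \<open>LEAST\<close> in \<open>rank_width\<close> meaningful: it is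
  attained by an actual decomposition.\<close>

lemma ex_rank_decomposition:
  assumes "2 \<le> card (pverts G)"
  shows "\<exists>T L. rank_decomposition G T L"
proof -
  obtain V E L where T: "cubic_tree V E"
    and L: "bij_betw L {t \<in> V. card (E `` {t}) = 1} (pverts G)"
    using ex_cubic_tree[OF le_add_diff_inverse2[OF assms, symmetric]] by blast
  let ?T = "\<lparr>pverts = V, parcs = E\<rparr>"
  have V: "finite V" "E \<subseteq> V \<times> V" "sym E" "irrefl E" "V \<noteq> {}"
    and conn: "\<And>s t. s \<in> V \<Longrightarrow> t \<in> V \<Longrightarrow> (s, t) \<in> E\<^sup>*"
    and uniq: "\<And>t s s'. (s, t) \<in> E \<Longrightarrow> (s', t) \<in> E \<Longrightarrow> s < t \<Longrightarrow> s' < t \<Longrightarrow> s = s'"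
    and deg: "\<And>t. t \<in> V \<Longrightarrow> card (E `` {t}) = 1 \<or> card (E `` {t}) = 3"
    using T unfolding cubic_tree_def by blast+
  have "finite E" using V(1,2) finite_subset by blast
  then interpret pair_graph ?T
    using V by unfold_locales (auto simp: symmetric_def irrefl_def)
  have "symcl E = E" using \<open>sym E\<close> by (auto simp: symcl_def dest: symD)
  moreover have "(s, t) \<in> rtrancl_on V E" if "s \<in> V" "t \<in> V" for s t
    using reachable_conv[of s t] conn[OF that] that by (simp add: reachable_def)
  ultimately have "connected (with_proj ?T)" using V(5) by (simp add: connected_conv)
  moreover have "\<not> (\<exists>p. cycle p \<and> 3 \<le> length p)"
    using no_long_cycle[OF pair_graph] uniq by fastforce
  ultimately have "undirected_tree ?T" by (simp add: undirected_tree_def pair_graph)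
  then have "rank_decomposition G ?T L"
    using L deg by (simp add: rank_decomposition_def leaves_def degree_eq_card_Image)
  then show ?thesis by blast
qed

section \<open>Large rank-width of separated grids, and low rank-width colourings\<close>

text \<open>The premise \<open>4 * k + 2 \<le> m\<close> serves two purposes: \<open>m\<close>
  exceeds the bound \<open>2 * k\<close> on mixed rows and columns, and \<open>m * m\<close> exceeds
  three times the bound \<open>2 * k * (2 * k)\<close> on the minority side.\<close>

lemma rank_width_grid_gt:
  fixes I J :: "nat set"
  assumes "pair_graph H" and fin: "finite I" "finite J"
    and m: "card I = m" "card J = m" "4 * k + 2 \<le> m"
    and a: "\<And>i. i \<in> I \<Longrightarrow> a i \<in> pverts H" and b: "\<And>j. j \<in> J \<Longrightarrow> b j \<in> pverts H"
    and z: "inj_on z (I \<times> J)" "z ` (I \<times> J) \<subseteq> pverts H"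
    and adj_a: "\<And>i i' j. i \<in> I \<Longrightarrow> i' \<in> I \<Longrightarrow> j \<in> J \<Longrightarrow> (a i, z (i', j)) \<in> parcs H \<longleftrightarrow> i \<le> i'"
    and adj_b: "\<And>j i j'. j \<in> J \<Longrightarrow> i \<in> I \<Longrightarrow> j' \<in> J \<Longrightarrow> (b j, z (i, j')) \<in> parcs H \<longleftrightarrow> j \<le> j'"
  shows "k < rank_width H"
proof (rule ccontr)
  assume "\<not> k < rank_width H"
  then have rw: "rank_width H \<le> k" by simp
  interpret H: pair_graph H by fact
  have finV: "finite (pverts H)" by (rule H.pair_finite_verts)
  have cardZ: "card (z ` (I \<times> J)) = m * m"
    using z(1) m by (simp add: card_image card_cartesian_product)
  have big: "(4 * k + 2) * (4 * k + 2) \<le> m * m" using m(3) by (rule mult_le_mono) fact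
  then have "2 \<le> m * m" by simp
  then have V2: "2 \<le> card (pverts H)" using card_mono[OF finV z(2)] cardZ by linarith
  let ?Q = "\<lambda>k. \<exists>T L. rank_decomposition H T L \<and> decomposition_width H T L = k"
  have "\<exists>k. ?Q k" using ex_rank_decomposition[OF V2] by blast
  then have "?Q (LEAST k. ?Q k)" by (rule LeastI_ex)
  then obtain T L where dec: "rank_decomposition H T L"
    and "decomposition_width H T L = (LEAST k. ?Q k)" by blast
  moreover have "rank_width H = (LEAST k. ?Q k)" using V2 by (simp add: rank_width_def)
  ultimately have width: "decomposition_width H T L \<le> k" using rw by simp
  have tree: "undirected_tree T" and L: "bij_betw L (leaves T) (pverts H)"
    and deg: "\<And>t. t \<in> pverts T \<Longrightarrow> degree T t = 1 \<or> degree T t = 3"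
    using dec by (auto simp: rank_decomposition_def)
  have injL: "inj_on L (leaves T)" and imL: "L ` leaves T = pverts H"
    using L by (auto simp: bij_betw_def)
  interpret T: pair_graph T using tree by (simp add: undirected_tree_def)
  \<comment> \<open>The edge is to be balanced with respect to the leaves labelled by grid vertices
    only.\<close>
  define W where "W = {t \<in> leaves T. L t \<in> z ` (I \<times> J)}"
  have "L ` W = z ` (I \<times> J)"
  proof
    show "z ` (I \<times> J) \<subseteq> L ` W"
    proof
      fix x assume x: "x \<in> z ` (I \<times> J)"
      then obtain t where "t \<in> leaves T" "x = L t" using z(2) imL by blast
      then show "x \<in> L ` W" using x by (simp add: W_def)
    qed
  qed (auto simp: W_def)
  then have "bij_betw L W (z ` (I \<times> J))"
    by (intro bij_betw_subset[OF L]) (auto simp: W_def)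
  then have cardW: "card W = m * m" using cardZ by (simp add: bij_betw_same_card)
  have WT: "W \<subseteq> pverts T" "\<And>t. t \<in> W \<Longrightarrow> card (parcs T `` {t}) \<le> 1"
    by (auto simp: W_def leaves_def degree_eq_card_Image)
  have deg3: "card (parcs T `` {t}) \<le> 3" if "t \<in> pverts T" for t
    using deg[OF that] by (auto simp: degree_eq_card_Image)
  have sym: "sym (parcs T)" using T.pair_sym_arcs by (simp add: symmetric_def)
  have sub: "parcs T \<subseteq> pverts T \<times> pverts T" using T.wellformed' by auto
  obtain s t where st: "(s, t) \<in> parcs T"
    and bal: "card W \<le> 3 * card (W \<inter> side (parcs T) s t)" "card W \<le> 3 * card (W - side (parcs T) s t)"
  proof (rule ex_balanced_edge[OF T.pair_finite_verts sub sym])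
    show "2 \<le> card W" using cardW \<open>2 \<le> m * m\<close> by simp
  qed (use undirected_tree_bridge[OF tree] undirected_tree_connected[OF tree] deg3 WT in auto)
  define X where "X = edge_side T L (s, t)"
  have "cut_rank H X \<le> decomposition_width H T L"
    unfolding decomposition_width_def X_def using st T.pair_finite_arcs by (intro Max_ge) auto
  then have cut: "cut_rank H X \<le> k" using width by simp
  have "s \<in> pverts T" using st T.wellformed' by blast
  then have X: "X = L ` {u \<in> leaves T. u \<in> side (parcs T) s t}"
    by (simp add: X_def edge_side_def reachable_delete_edge_iff[OF T.pair_graph])
  have "X \<subseteq> pverts H" unfolding X imL[symmetric] by blast
  then have finX: "finite X" using finV by (rule finite_subset)
  define S where "S = {ij. z ij \<in> X}"
  have "card {i \<in> I. z ` ({i} \<times> J) \<inter> X \<noteq> {} \<and> z ` ({i} \<times> J) - X \<noteq> {}} \<le> 2 * cut_rank H X"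
    using finX fin(1) H.pair_sym_arcs
    by (rule card_mixed_lines_le[where a = a]) (use a z(2) adj_a in auto)
  moreover have "{i \<in> I. z ` ({i} \<times> J) \<inter> X \<noteq> {} \<and> z ` ({i} \<times> J) - X \<noteq> {}} =
      {i \<in> I. (\<exists>j\<in>J. (i, j) \<in> S) \<and> (\<exists>j\<in>J. (i, j) \<notin> S)}"
    by (auto simp: S_def)
  ultimately have rows: "card {i \<in> I. (\<exists>j\<in>J. (i, j) \<in> S) \<and> (\<exists>j\<in>J. (i, j) \<notin> S)} \<le> 2 * k"
    using cut by simp
  have "card {j \<in> J. z ` (I \<times> {j}) \<inter> X \<noteq> {} \<and> z ` (I \<times> {j}) - X \<noteq> {}} \<le> 2 * cut_rank H X"
    using finX fin(2) H.pair_sym_arcs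
    by (rule card_mixed_lines_le[where a = b]) (use b z(2) adj_b in auto)
  moreover have "{j \<in> J. z ` (I \<times> {j}) \<inter> X \<noteq> {} \<and> z ` (I \<times> {j}) - X \<noteq> {}} =
      {j \<in> J. (\<exists>i\<in>I. (i, j) \<in> S) \<and> (\<exists>i\<in>I. (i, j) \<notin> S)}"
    by (auto simp: S_def)
  ultimately have cols: "card {j \<in> J. (\<exists>i\<in>I. (i, j) \<in> S) \<and> (\<exists>i\<in>I. (i, j) \<notin> S)} \<le> 2 * k"
    using cut by simp
  have "card (I \<times> J \<inter> S) \<le> 2 * k * (2 * k) \<or> card (I \<times> J - S) \<le> 2 * k * (2 * k)"
    using grid_minority_card_le[OF fin rows cols] m by simp
  \<comment> \<open>Since \<open>L\<close> is injective, leaves on the side correspond to cells in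
    \<open>S\<close> and the others to cells outside it; this transfers the balance to the
    grid.\<close>
  moreover have "card (W \<inter> side (parcs T) s t) \<le> card (I \<times> J \<inter> S)"
  proof -
    have "L ` (W \<inter> side (parcs T) s t) \<subseteq> z ` (I \<times> J \<inter> S)"
    proof
      fix y assume "y \<in> L ` (W \<inter> side (parcs T) s t)"
      then have "y \<in> z ` (I \<times> J)" "y \<in> X" by (auto simp: W_def X)
      then show "y \<in> z ` (I \<times> J \<inter> S)" by (auto simp: S_def)
    qed
    moreover have "inj_on L (W \<inter> side (parcs T) s t)"
      using injL by (rule inj_on_subset) (auto simp: W_def)
    ultimately show ?thesis using fin by (meson card_image_le card_inj_on_le finite_Int finite_SigmaI finite_imageI order_trans)
  qed
  moreover have "card (W - side (parcs T) s t) \<le> card (I \<times> J - S)"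
  proof -
    have "L u \<notin> X" if "u \<in> W - side (parcs T) s t" for u
    proof
      assume "L u \<in> X"
      then obtain u' where u': "u' \<in> leaves T" "u' \<in> side (parcs T) s t" "L u = L u'"
        by (auto simp: X)
      then have "u = u'" using injL that by (auto simp: W_def dest: inj_onD)
      then show False using u' that by simp
    qed
    then have "L ` (W - side (parcs T) s t) \<subseteq> z ` (I \<times> J - S)"
      by (fastforce simp: W_def S_def)
    moreover have "inj_on L (W - side (parcs T) s t)"
      using injL by (rule inj_on_subset) (auto simp: W_def)
    ultimately show ?thesis using fin by (meson finite_Diff finite_SigmaI card_inj_on_le finite_imageI card_image_le order_trans)
  qed
  ultimately have "m * m \<le> 3 * (2 * k * (2 * k))" using bal cardW by linarith
  then show False using big by (simp add: algebra_simps)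
qed

theorem theorem6:
  fixes \<C> :: "'a pair_pre_digraph set"
  assumes "hereditary_graph_class \<C>"
    and "\<And>n::nat. 1 \<le> n \<Longrightarrow> \<exists>G \<in> \<C>. twisted_chain_graph n G"
  shows "\<not> admits_low_rank_width_colorings \<C>"
proof
  assume "admits_low_rank_width_colorings \<C>"
  then obtain N Q :: "nat \<Rightarrow> nat" where NQ: "\<And>p G. G \<in> \<C> \<Longrightarrow> \<exists>c :: 'a \<Rightarrow> nat.
      card (c ` pverts G) \<le> N p \<and> (\<forall>I \<subseteq> c ` pverts G. card I \<le> p \<longrightarrow>
        rank_width (induce G {v \<in> pverts G. c v \<in> I}) \<le> Q (card I))"
    unfolding admits_low_rank_width_colorings_def by metis
  \<comment> \<open>The number of colours finally used is only known to be at most 3, and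
    \<open>Q\<close> need not be monotone; the sum dominates every possible value.\<close>
  define k where "k = Q 0 + Q 1 + Q 2 + Q 3"
  define m where "m = 4 * k + 2"
  \<comment> \<open>A cell is coloured by a triple of colours, each from at most \<open>N 3\<close>
    values. Thus \<open>n\<close> depends on \<open>N\<close> and \<open>Q\<close> alone and is
    fixed before the graph.\<close>
  obtain n where n: "1 \<le> n" and mono: "\<And>f :: nat \<times> nat \<Rightarrow> nat \<times> nat \<times> nat.
      card (f ` ({1..n} \<times> {1..n})) \<le> N 3 * (N 3 * N 3) \<Longrightarrow>
      \<exists>I \<subseteq> {1..n}. \<exists>J \<subseteq> {1..n}. \<exists>b. card I = m \<and> card J = m \<and> (\<forall>i\<in>I. \<forall>j\<in>J. f (i, j) = b)"
    using ex_monochromatic_subgrid[where C = "N 3 * (N 3 * N 3)" and m = m] by metis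
  obtain G where G: "G \<in> \<C>" "twisted_chain_graph n G" using assms(2) n by blast
  obtain c :: "'a \<Rightarrow> nat" where c: "card (c ` pverts G) \<le> N 3"
    and low: "\<And>I. I \<subseteq> c ` pverts G \<Longrightarrow> card I \<le> 3 \<Longrightarrow>
      rank_width (induce G {v \<in> pverts G. c v \<in> I}) \<le> Q (card I)"
    using NQ[OF G(1), of 3] by blast
  obtain v w z where z: "inj_on z ({1..n} \<times> {1..n})"
    and V: "pverts G = v ` {1..n\<^sup>2} \<union> w ` {1..n\<^sup>2} \<union> z ` ({1..n} \<times> {1..n})"
    and adj: "\<And>x y i j. x \<in> {1..n} \<Longrightarrow> y \<in> {1..n} \<Longrightarrow> i \<in> {1..n} \<Longrightarrow> j \<in> {1..n} \<Longrightarrow>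
      ((v (n * (x - 1) + y), z (i, j)) \<in> parcs G \<longleftrightarrow> x < i \<or> x = i \<and> y \<le> j) \<and>
      ((w (n * (x - 1) + y), z (i, j)) \<in> parcs G \<longleftrightarrow> x < j \<or> x = j \<and> y \<le> i)"
    using G(2) unfolding twisted_chain_graph_def
    by (elim conjE exE) (rule that, assumption, assumption, simp)
  \<comment> \<open>These are the vertices with \<open>y = 1\<close>: as \<open>1 \<le> j\<close>
    always holds, the lexicographic adjacency condition collapses to \<open>x \<le> i\<close>, or to
    \<open>x \<le> j\<close> for \<open>b\<close>.\<close>
  define a where "a i = v (n * (i - 1) + 1)" for i
  define b where "b i = w (n * (i - 1) + 1)" for i
  have idx: "n * (i - 1) + 1 \<in> {1..n\<^sup>2}" if "i \<in> {1..n}" for i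
  proof -
    have "n * (i - 1) + 1 \<le> n * (i - 1) + n" using n by simp
    also have "\<dots> = n * i" using that by (cases i) auto
    also have "\<dots> \<le> n\<^sup>2" using that by (simp add: power2_eq_square)
    finally show ?thesis by simp
  qed
  have aV: "a i \<in> pverts G" and bV: "b i \<in> pverts G" if "i \<in> {1..n}" for i
    using idx[OF that] V by (auto simp: a_def b_def)
  have zV: "z ij \<in> pverts G" if "ij \<in> {1..n} \<times> {1..n}" for ij
    using that V by blast
  have adj_a: "(a x, z (i, j)) \<in> parcs G \<longleftrightarrow> x \<le> i"
    and adj_b: "(b x, z (i, j)) \<in> parcs G \<longleftrightarrow> x \<le> j"
    if "x \<in> {1..n}" "i \<in> {1..n}" "j \<in> {1..n}" for x i j
    using adj[of x 1 i j] that n by (auto simp: a_def b_def)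
  define f where "f = (\<lambda>(i, j). (c (a i), c (b j), c (z (i, j))))"
  have "finite (pverts G)" using V by simp
  then have "card (f ` ({1..n} \<times> {1..n})) \<le>
      card (c ` pverts G \<times> c ` pverts G \<times> c ` pverts G)"
    using aV bV zV by (intro card_mono) (auto simp: f_def)
  also have "\<dots> \<le> N 3 * (N 3 * N 3)"
    using c by (simp only: card_cartesian_product mult_le_mono)
  finally obtain I J d where IJ: "I \<subseteq> {1..n}" "J \<subseteq> {1..n}" "card I = m" "card J = m"
    and d: "\<And>i j. i \<in> I \<Longrightarrow> j \<in> J \<Longrightarrow> f (i, j) = d"
    using mono[of f] by blast
  obtain \<alpha> \<beta> \<gamma> where d_eq: "d = (\<alpha>, \<beta>, \<gamma>)" by (cases d)
  have fin: "finite I" "finite J" using IJ finite_subset by blast+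
  \<comment> \<open>With both index sets nonempty, the constant triple fixes one colour for all
    \<open>a i\<close>, one for all \<open>b j\<close> and one for all cells.\<close>
  have "I \<noteq> {}" "J \<noteq> {}" using IJ by (auto simp: m_def)
  then have col_a: "c (a i) = \<alpha>" if "i \<in> I" for i
    using d that by (force simp: f_def d_eq)
  have col_b: "c (b j) = \<beta>" if "j \<in> J" for j
    using d that \<open>I \<noteq> {}\<close> by (force simp: f_def d_eq)
  have col_z: "c (z (i, j)) = \<gamma>" if "i \<in> I" "j \<in> J" for i j
    using d[OF that] by (simp add: f_def d_eq)
  obtain i0 j0 where ij0: "i0 \<in> I" "j0 \<in> J" using \<open>I \<noteq> {}\<close> \<open>J \<noteq> {}\<close> by blast
  define K where "K = {\<alpha>, \<beta>, \<gamma>}"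
  have "c (a i0) \<in> c ` pverts G" "c (b j0) \<in> c ` pverts G" "c (z (i0, j0)) \<in> c ` pverts G"
    using ij0 IJ aV bV zV by (intro imageI; blast)+
  then have K: "K \<subseteq> c ` pverts G" using ij0 by (simp add: K_def col_a col_b col_z)
  have K3: "card K \<le> 3" unfolding K_def by (simp add: card_insert_if)
  let ?U = "{u \<in> pverts G. c u \<in> K}"
  \<comment> \<open>The three colours may coincide, so each cardinality up to 3 is covered.\<close>
  have "card K \<in> {0, 1, 2, 3}" using K3 by auto
  then have "Q (card K) \<le> k" by (auto simp: k_def)
  then have "rank_width (induce G ?U) \<le> k" using low[OF K K3] by linarith
  moreover have "k < rank_width (induce G ?U)"
  proof (rule rank_width_grid_gt[where a = a and b = b and z = z, OF _ fin IJ(3,4)])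
    have her: "pair_graph G'" "\<And>S. S \<subseteq> pverts G' \<Longrightarrow> induce G' S \<in> \<C>" if "G' \<in> \<C>" for G'
      using assms(1) that unfolding hereditary_graph_class_def by simp_all
    show "pair_graph (induce G ?U)" by (intro her G(1)) simp
    show "4 * k + 2 \<le> m" by (simp add: m_def)
    show aU: "a i \<in> pverts (induce G ?U)" if "i \<in> I" for i
      using that IJ aV col_a by (auto simp: induce_def K_def)
    show bU: "b j \<in> pverts (induce G ?U)" if "j \<in> J" for j
      using that IJ bV col_b by (auto simp: induce_def K_def)
    show "inj_on z (I \<times> J)" using z IJ(1,2) by (rule inj_on_subset[OF _ Sigma_mono])
    show zU: "z ` (I \<times> J) \<subseteq> pverts (induce G ?U)"
      using IJ zV col_z by (auto simp: induce_def K_def)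
    show "(a i, z (i', j)) \<in> parcs (induce G ?U) \<longleftrightarrow> i \<le> i'"
      if "i \<in> I" "i' \<in> I" "j \<in> J" for i i' j
    proof -
      have "a i \<in> ?U" "z (i', j) \<in> ?U" using aU zU that by (auto simp: induce_def)
      moreover have "i \<in> {1..n}" "i' \<in> {1..n}" "j \<in> {1..n}" using that IJ by auto
      ultimately show ?thesis using adj_a by (simp add: induce_def)
    qed
    show "(b j, z (i, j')) \<in> parcs (induce G ?U) \<longleftrightarrow> j \<le> j'"
      if "j \<in> J" "i \<in> I" "j' \<in> J" for j i j'
    proof -
      have "b j \<in> ?U" "z (i, j') \<in> ?U" using bU zU that by (auto simp: induce_def)
      moreover have "j \<in> {1..n}" "i \<in> {1..n}" "j' \<in> {1..n}" using that IJ by auto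
      ultimately show ?thesis using adj_b by (simp add: induce_def)
    qed
  qed
  ultimately show False by simp
qed

end
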